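(* Let $(\Omega,\mathcal F,\mathbb P)$ be a probability space, $\mathcal A\subseteq\mathcal F$ a $\sigma$-lattice, $Y$ a random variable, and $V$ an identification function such that $\mathbb E(V(\eta,Y))$ is finite for all $\eta\in\mathbb R$. Let $T$ be the functional induced by $V$, and let $T(Y\mid\mathcal A)$ be the conditional functional of $Y$ given $\mathcal A$ (constructed from a decreasing minimizing path). Then $T(Y\mid\mathcal A)$ is $\mathcal A$-measurable and, for all $\eta\in\mathbb R$, minimizes $$\int_{\{X\ge\eta\}}V(\eta,Y)\,\mathrm d\mathbb P$$ over all $\mathcal A$-measurable random variables $X$. If the elementary loss functions $$S_\eta(x,y)=V(\eta,y)\mathbf 1_{\{y<\eta\le x\}}-V(\eta,y)\mathbf 1_{\{x<\eta\le y\}},\quad\eta\in\mathbb R,$$ are nonnegative, then for every consistent scoring function $S$ for $T$ with representation $S(x,y)=\int S_\eta(x,y)\,\mathrm dH(\eta)$ for some $\sigma$-finite measure $H$ on $\mathbb R$, the expectation $\mathbb E(S(X,Y))$ always exists, and $T(Y\mid\mathcal A)$ minimizes $\mathbb E(S(X,Y))$ over all $\mathcal A$-measurable random variables $X$.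
   Context: A $\sigma$-lattice $\mathcal A\subseteq\mathcal F$ contains $\emptyset,\Omega$ and is closed under countable unions and intersections; $X$ is $\mathcal A$-measurable if $\{X>x\}\in\mathcal A$ for all $x\in\mathbb R$. An identification function is a function $V:\mathbb R\times\mathbb R\to\mathbb R$ such that $V(\cdot,y)$ is increasing (nondecreasing) and left-continuous for all $y\in\mathbb R$. The functional $T$ induced by $V$ assigns to each probability distribution $F$ on $\mathbb R$ the set $T(F)=[T_F^-,T_F^+]\subseteq[-\infty,\infty]$ with $T_F^-=\sup\{x\mid\int V(x,y)\,\mathrm dF(y)<0\}$ and $T_F^+=\inf\{x\mid\int V(x,y)\,\mathrm dF(y)>0\}$. A measurable map $S:\mathbb R\times\mathbb R\to[-\infty,\infty]$ is a consistent scoring function for $T$ relative to a class $\mathcal P$ of distributions if for all $x\in\mathbb R$ and $F\in\mathcal P$ the integral $\int S(x,y)\,\mathrm dF(y)$ exists and $\int S(t,y)\,\mathrm dF(y)\le\int S(x,y)\,\mathrm dF(y)$ for all $t\in T(F)$. For $A\in\mathcal A$ and $\eta\in\mathbb R$ let $s_A(\eta)=\mathbb E(\mathbf 1_AV(\eta,Y))$, and let $M(\eta)$ be the family of all $A\in\mathcal A$ that minimize $s_A(\eta)$ over $A\in\mathcal A$. A minimizing path is a family $(A_\eta)_{\eta\in\mathbb R}\subseteq\mathcal A$ with $A_\eta\in M(\eta)$ for all $\eta$; it is decreasing if $A_{\eta'}\subseteq A_\eta$ for all $\eta<\eta'$. Given a decreasing minimizing path $(A_\eta)_{\eta\in\mathbb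 R}$, the conditional functional is $T(Y\mid\mathcal A)(\omega)=\sup\{\eta\in\mathbb R\mid\omega\in A_\eta\}$, $\omega\in\Omega$ (it may depend on the chosen path). *)

theory Defs
  imports "HOL-Probability.Probability"
begin

text \<open>Integrals with values in the extended reals. An integral exists if the positive or the
  negative part has a finite integral; the library's Bochner integral does not cover infinite
  values, and it assigns 0 to non-integrable functions. \<open>ext_integral\<close> is meaningful only under
  \<open>ext_integral_exists\<close>.\<close>

definition ext_integral_exists :: "'a measure \<Rightarrow> ('a \<Rightarrow> ereal) \<Rightarrow> bool" where
  "ext_integral_exists M f \<longleftrightarrow> f \<in> borel_measurable M \<and>
     ((\<integral>\<^sup>+x. e2ennreal (f x) \<partial>M) < \<infinity> \<or> (\<integral>\<^sup>+x. e2ennreal (- f x) \<partial>M) < \<infinity>)"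

definition ext_integral :: "'a measure \<Rightarrow> ('a \<Rightarrow> ereal) \<Rightarrow> ereal" where
  "ext_integral M f =
     enn2ereal (\<integral>\<^sup>+x. e2ennreal (f x) \<partial>M) - enn2ereal (\<integral>\<^sup>+x. e2ennreal (- f x) \<partial>M)"

definition sigma_lattice :: "'a measure \<Rightarrow> 'a set set \<Rightarrow> bool" where
  "sigma_lattice M \<A> \<longleftrightarrow> \<A> \<subseteq> sets M \<and> {} \<in> \<A> \<and> space M \<in> \<A> \<and>
     (\<forall>B :: nat \<Rightarrow> 'a set. range B \<subseteq> \<A> \<longrightarrow> (\<Union>n. B n) \<in> \<A> \<and> (\<Inter>n. B n) \<in> \<A>)"

text \<open>Random variables are extended real valued, because the conditional functional may attain
  infinite values. As \<open>\<A> \<subseteq> sets M\<close>, this entails Borel measurability.\<close>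

definition lattice_measurable :: "'a measure \<Rightarrow> 'a set set \<Rightarrow> ('a \<Rightarrow> ereal) \<Rightarrow> bool" where
  "lattice_measurable M \<A> X \<longleftrightarrow> (\<forall>x::real. {\<omega> \<in> space M. X \<omega> > ereal x} \<in> \<A>)"

definition identification_function :: "(real \<Rightarrow> real \<Rightarrow> real) \<Rightarrow> bool" where
  "identification_function V \<longleftrightarrow>
     (\<forall>y. mono (\<lambda>x. V x y) \<and> (\<forall>x. continuous (at_left x) (\<lambda>z. V z y)))"

definition T_lower :: "(real \<Rightarrow> real \<Rightarrow> real) \<Rightarrow> real measure \<Rightarrow> ereal" where
  "T_lower V F = Sup {ereal x | x. ext_integral_exists F (\<lambda>y. ereal (V x y)) \<and>
                                   ext_integral F (\<lambda>y. ereal (V x y)) < 0}"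

definition T_upper :: "(real \<Rightarrow> real \<Rightarrow> real) \<Rightarrow> real measure \<Rightarrow> ereal" where
  "T_upper V F = Inf {ereal x | x. ext_integral_exists F (\<lambda>y. ereal (V x y)) \<and>
                                   ext_integral F (\<lambda>y. ereal (V x y)) > 0}"

definition induced_functional :: "(real \<Rightarrow> real \<Rightarrow> real) \<Rightarrow> real measure \<Rightarrow> ereal set" where
  "induced_functional V F = {T_lower V F .. T_upper V F}"

text \<open>Scores are defined for real forecasts only, so the comparison involves the real elements
  of \<open>T F\<close>.\<close>

definition consistent_scoring_function ::
    "real measure set \<Rightarrow> (real measure \<Rightarrow> ereal set) \<Rightarrow> (real \<Rightarrow> real \<Rightarrow> ereal) \<Rightarrow> bool" where
  "consistent_scoring_function \<P> T S \<longleftrightarrow>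
     (\<lambda>(x, y). S x y) \<in> borel_measurable (borel \<Otimes>\<^sub>M borel) \<and>
     (\<forall>x. \<forall>F\<in>\<P>. ext_integral_exists F (S x) \<and>
        (\<forall>t. ereal t \<in> T F \<longrightarrow> ext_integral F (S t) \<le> ext_integral F (S x)))"

definition elementary_loss :: "(real \<Rightarrow> real \<Rightarrow> real) \<Rightarrow> real \<Rightarrow> real \<Rightarrow> real \<Rightarrow> real" where
  "elementary_loss V \<eta> x y =
     V \<eta> y * of_bool (y < \<eta> \<and> \<eta> \<le> x) - V \<eta> y * of_bool (x < \<eta> \<and> \<eta> \<le> y)"

definition has_elementary_representation ::
    "(real \<Rightarrow> real \<Rightarrow> real) \<Rightarrow> real measure \<Rightarrow> (real \<Rightarrow> real \<Rightarrow> ereal) \<Rightarrow> bool" where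
  "has_elementary_representation V H S \<longleftrightarrow>
     (\<forall>x y. ext_integral_exists H (\<lambda>\<eta>. ereal (elementary_loss V \<eta> x y)) \<and>
            S x y = ext_integral H (\<lambda>\<eta>. ereal (elementary_loss V \<eta> x y)))"

text \<open>Extension of a score to infinite forecasts by limits. For a mixture of nonnegative
  elementary losses, \<open>S x y\<close> is monotone in \<open>x\<close> on either side of \<open>y\<close>, so the limits exist.\<close>

definition extend_score :: "(real \<Rightarrow> real \<Rightarrow> ereal) \<Rightarrow> ereal \<Rightarrow> real \<Rightarrow> ereal" where
  "extend_score S x y = (case x of
       ereal r \<Rightarrow> S r y
     | PInfty \<Rightarrow> Lim at_top (\<lambda>r. S r y)
     | MInfty \<Rightarrow> Lim at_bot (\<lambda>r. S r y))"

definition path_score ::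
    "'a measure \<Rightarrow> (real \<Rightarrow> real \<Rightarrow> real) \<Rightarrow> ('a \<Rightarrow> real) \<Rightarrow> 'a set \<Rightarrow> real \<Rightarrow> real" where
  "path_score M V Y A \<eta> = (LINT \<omega>:A|M. V \<eta> (Y \<omega>))"

definition minimizers ::
    "'a measure \<Rightarrow> 'a set set \<Rightarrow> (real \<Rightarrow> real \<Rightarrow> real) \<Rightarrow> ('a \<Rightarrow> real) \<Rightarrow> real \<Rightarrow> 'a set set" where
  "minimizers M \<A> V Y \<eta> =
     {A \<in> \<A>. \<forall>B\<in>\<A>. path_score M V Y A \<eta> \<le> path_score M V Y B \<eta>}"

definition decreasing_minimizing_path ::
    "'a measure \<Rightarrow> 'a set set \<Rightarrow> (real \<Rightarrow> real \<Rightarrow> real) \<Rightarrow> ('a \<Rightarrow> real) \<Rightarrow> (real \<Rightarrow> 'a set) \<Rightarrow> bool" where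
  "decreasing_minimizing_path M \<A> V Y A \<longleftrightarrow>
     (\<forall>\<eta>. A \<eta> \<in> minimizers M \<A> V Y \<eta>) \<and> (\<forall>\<eta> \<eta>'. \<eta> < \<eta>' \<longrightarrow> A \<eta>' \<subseteq> A \<eta>)"

definition conditional_functional :: "(real \<Rightarrow> 'a set) \<Rightarrow> 'a \<Rightarrow> ereal" where
  "conditional_functional A \<omega> = Sup {ereal \<eta> | \<eta>. \<omega> \<in> A \<eta>}"

end

theory Submission
  imports Defs
begin

text \<open>Level sets of the conditional functional are countable intersections
  \<open>{T(Y | \<A>) \<ge> \<eta>} = (\<Inter>n. A (q n))\<close> with \<open>q n\<close> increasing strictly to \<open>\<eta>\<close>; passing to the limit in
  the minimality of \<open>A (q n)\<close> at level \<open>q n\<close>, by dominated convergence and left-continuity of \<open>V\<close>,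
  shows that the level set is minimal at level \<open>\<eta>\<close>. The elementary loss equals
  \<open>V \<eta> y * (1{\<eta> \<le> x} - 1{\<eta> \<le> y})\<close>, so its expectation differs from the integral of \<open>V \<eta> Y\<close> over
  \<open>{X \<ge> \<eta>}\<close> by a term that does not depend on \<open>X\<close>. Tonelli then carries the optimality
  for every \<open>\<eta>\<close> over to the mixture.\<close>

section \<open>Sigma-lattices and level sets\<close>

text \<open>Carries closure under unions from sequences to countable index sets, such as the
  rational thresholds used for the conditional functional. The empty index set is where
  \<open>{} \<in> \<A>\<close> enters.\<close>

lemma sigma_lattice_countable_UN:
  assumes "sigma_lattice M \<A>" "countable I" "\<And>i. i \<in> I \<Longrightarrow> B i \<in> \<A>"
  shows "(\<Union>i\<in>I. B i) \<in> \<A>"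
proof (cases "I = {}")
  case True
  then show ?thesis using assms(1) by (simp add: sigma_lattice_def)
next
  case False
  have "(\<Union>i\<in>I. B i) = (\<Union>n. B (from_nat_into I n))"
    using range_from_nat_into[OF False assms(2)] by (metis image_image)
  moreover have "range (\<lambda>n. B (from_nat_into I n)) \<subseteq> \<A>"
    using assms(3) from_nat_into[OF False] by auto
  ultimately show ?thesis using assms(1) by (simp add: sigma_lattice_def)
qed

lemma sigma_lattice_INT:
  assumes "sigma_lattice M \<A>" "\<And>n::nat. B n \<in> \<A>"
  shows "(\<Inter>n. B n) \<in> \<A>"
  using assms by (auto simp: sigma_lattice_def)

text \<open>Strictness of \<open>q n < \<eta>\<close> gives one direction, the limit the other. This
  turns sets of the form {X \<ge> \<eta>} into countable intersections of sets {X > x}.\<close>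

lemma ereal_le_iff_all_less:
  fixes q :: "nat \<Rightarrow> real"
  assumes "\<And>n. q n < \<eta>" "q \<longlonglongrightarrow> \<eta>"
  shows "ereal \<eta> \<le> x \<longleftrightarrow> (\<forall>n. ereal (q n) < x)"
proof
  assume "ereal \<eta> \<le> x"
  then show "\<forall>n. ereal (q n) < x"
    using assms(1) by (meson less_ereal.simps(1) less_le_trans)
next
  assume *: "\<forall>n. ereal (q n) < x"
  have "(\<lambda>n. ereal (q n)) \<longlonglongrightarrow> ereal \<eta>" using assms(2) by simp
  then show "ereal \<eta> \<le> x"
    by (rule LIMSEQ_le_const2) (use * in \<open>auto intro: less_imp_le\<close>)
qed

lemma strict_left_approximation:
  fixes \<eta> :: real
  shows "\<eta> - 1 / real (Suc n) < \<eta>" "(\<lambda>n. \<eta> - 1 / real (Suc n)) \<longlonglongrightarrow> \<eta>"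
proof -
  show "\<eta> - 1 / real (Suc n) < \<eta>" by simp
  show "(\<lambda>n. \<eta> - 1 / real (Suc n)) \<longlonglongrightarrow> \<eta>"
    using tendsto_diff[OF tendsto_const[of \<eta>] LIMSEQ_inverse_real_of_nat]
    by (simp add: inverse_eq_divide)
qed

text \<open>A sigma-lattice need not be closed under complements, so the closed level set is built
  from the open ones by a countable intersection alone.\<close>

lemma lattice_measurable_ge:
  assumes "sigma_lattice M \<A>" "lattice_measurable M \<A> X"
  shows "{\<omega> \<in> space M. X \<omega> \<ge> ereal \<eta>} \<in> \<A>"
proof -
  have "{\<omega> \<in> space M. X \<omega> \<ge> ereal \<eta>}
      = (\<Inter>n. {\<omega> \<in> space M. X \<omega> > ereal (\<eta> - 1 / real (Suc n))})"
    unfolding ereal_le_iff_all_less[OF strict_left_approximation] by auto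
  then show ?thesis
    using sigma_lattice_INT[OF assms(1)] assms(2) by (simp add: lattice_measurable_def)
qed

lemma lattice_measurable_borel:
  assumes "sigma_lattice M \<A>" "lattice_measurable M \<A> X"
  shows "X \<in> borel_measurable M"
proof -
  have r: "{\<omega> \<in> space M. ereal x < X \<omega>} \<in> sets M" for x
    using assms by (auto simp: lattice_measurable_def sigma_lattice_def)
  have "{\<omega> \<in> space M. a < X \<omega>} \<in> sets M" for a
  proof (cases a)
    \<comment> \<open>Lattice measurability speaks of real thresholds only. A value exceeds
      -\<infinity> iff it exceeds some negative integer or zero, which gives a countable
      union.\<close>
    case MInf
    have "{\<omega> \<in> space M. - \<infinity> < X \<omega>} = (\<Union>n::nat. {\<omega> \<in> space M. ereal (- real n) < X \<omega>})"
    proof (intro set_eqI iffI)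
      fix \<omega> assume "\<omega> \<in> {\<omega> \<in> space M. - \<infinity> < X \<omega>}"
      then show "\<omega> \<in> (\<Union>n::nat. {\<omega> \<in> space M. ereal (- real n) < X \<omega>})"
      proof (cases "X \<omega>")
        case (real r)
        then show ?thesis
          using \<open>\<omega> \<in> _\<close> reals_Archimedean2[of "-r"] by (auto simp: minus_less_iff)
      qed auto
    qed auto
    then show ?thesis using r MInf by auto
  qed (use r in auto)
  then show ?thesis unfolding borel_measurable_ereal_iff_Ioi
    by (simp add: vimage_def Int_def conj_commute)
qed

section \<open>The conditional functional\<close>

lemma less_conditional_functional_iff:
  "ereal x < conditional_functional A \<omega> \<longleftrightarrow> (\<exists>\<eta>>x. \<omega> \<in> A \<eta>)"
  by (auto simp: conditional_functional_def less_Sup_iff)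

lemma decreasing_minimizing_pathD:
  assumes "decreasing_minimizing_path M \<A> V Y A"
  shows "A \<eta> \<in> \<A>"
    and "B \<in> \<A> \<Longrightarrow> path_score M V Y (A \<eta>) \<eta> \<le> path_score M V Y B \<eta>"
    and "\<eta> \<le> \<eta>' \<Longrightarrow> A \<eta>' \<subseteq> A \<eta>"
  using assms unfolding decreasing_minimizing_path_def minimizers_def
  by (blast, blast, metis le_less order_refl)

text \<open>The set where the supremum exceeds x is the union of all \<open>A \<eta>\<close> with
  \<eta> > x. Since the path is decreasing, each \<open>A \<eta>\<close> is contained in some
  \<open>A q\<close> with q rational and x < q < \<eta>, so a countable union suffices.\<close>

lemma lattice_measurable_conditional_functional:
  assumes lat: "sigma_lattice M \<A>" and path: "decreasing_minimizing_path M \<A> V Y A"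
  shows "lattice_measurable M \<A> (conditional_functional A)"
  unfolding lattice_measurable_def
proof
  fix x :: real
  note D = decreasing_minimizing_pathD[OF path]
  have sub: "A \<eta> \<subseteq> space M" for \<eta>
    using D(1)[of \<eta>] lat sets.sets_into_space unfolding sigma_lattice_def by blast
  have "{\<omega> \<in> space M. ereal x < conditional_functional A \<omega>} = (\<Union>q\<in>{q\<in>\<rat>. q > x}. A q)"
  proof (intro set_eqI iffI)
    fix \<omega> assume "\<omega> \<in> {\<omega> \<in> space M. ereal x < conditional_functional A \<omega>}"
    then obtain \<eta> where \<eta>: "\<eta> > x" "\<omega> \<in> A \<eta>" by (auto simp: less_conditional_functional_iff)
    obtain q where "q \<in> \<rat>" "x < q" "q < \<eta>" using Rats_dense_in_real[OF \<eta>(1)] by blast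
    then show "\<omega> \<in> (\<Union>q\<in>{q\<in>\<rat>. q > x}. A q)" using D(3)[of q \<eta>] \<eta>(2) by auto
  next
    fix \<omega> assume "\<omega> \<in> (\<Union>q\<in>{q\<in>\<rat>. q > x}. A q)"
    then show "\<omega> \<in> {\<omega> \<in> space M. ereal x < conditional_functional A \<omega>}"
      using sub by (auto simp: less_conditional_functional_iff)
  qed
  moreover have "countable {q\<in>\<rat>. q > x}"
    using countable_rat by (rule countable_subset[rotated]) auto
  ultimately show "{\<omega> \<in> space M. ereal x < conditional_functional A \<omega>} \<in> \<A>"
    using sigma_lattice_countable_UN[OF lat, of "{q\<in>\<rat>. q > x}" A] D(1) by simp
qed

section \<open>Optimality of the level sets at each threshold\<close>

lemma identification_function_left_limit:
  assumes "identification_function V" "\<And>n::nat. q n < \<eta>" "q \<longlonglongrightarrow> \<eta>"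
  shows "(\<lambda>n. V (q n) y) \<longlonglongrightarrow> V \<eta> y"
proof -
  have "((\<lambda>z. V z y) \<longlongrightarrow> V \<eta> y) (at_left \<eta>)"
    using assms(1) by (auto simp: identification_function_def continuous_within)
  moreover have "filterlim q (at_left \<eta>) sequentially"
    using assms(2,3) by (auto simp: filterlim_at less_imp_neq)
  ultimately show ?thesis by (rule filterlim_compose)
qed

lemma identification_function_mono:
  assumes "identification_function V" "\<eta> \<le> \<eta>'"
  shows "V \<eta> y \<le> V \<eta>' y"
  using assms by (auto simp: identification_function_def mono_def)

text \<open>Dominated convergence. By monotonicity \<open>V (q n)\<close> lies between
  \<open>V l\<close> and \<open>V \<eta>\<close>, which is why a common lower bound \<open>l\<close>
  is assumed. The sets may vary with n, so that both the path and a fixed competitor are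
  covered.\<close>

lemma tendsto_path_score:
  assumes V: "identification_function V"
    and int: "\<And>\<eta>. integrable M (\<lambda>\<omega>. V \<eta> (Y \<omega>))"
    and q: "\<And>n. q n < \<eta>" "q \<longlonglongrightarrow> \<eta>" "\<And>n. l \<le> q n"
    and B: "\<And>n. B n \<in> sets M" "C \<in> sets M"
    and lim: "\<And>\<omega>. (\<lambda>n. indicator (B n) \<omega>) \<longlonglongrightarrow> (indicator C \<omega> :: real)"
  shows "(\<lambda>n. path_score M V Y (B n) (q n)) \<longlonglongrightarrow> path_score M V Y C \<eta>"
  unfolding path_score_def set_lebesgue_integral_def
proof (rule integral_dominated_convergence[where w = "\<lambda>\<omega>. \<bar>V l (Y \<omega>)\<bar> + \<bar>V \<eta> (Y \<omega>)\<bar>"])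
  have [measurable]: "(\<lambda>\<omega>. V \<eta> (Y \<omega>)) \<in> borel_measurable M" for \<eta>
    using int by auto
  note B [measurable]
  show "(\<lambda>\<omega>. indicat_real C \<omega> *\<^sub>R V \<eta> (Y \<omega>)) \<in> borel_measurable M" by measurable
  show "(\<lambda>\<omega>. indicat_real (B n) \<omega> *\<^sub>R V (q n) (Y \<omega>)) \<in> borel_measurable M" for n by measurable
  show "integrable M (\<lambda>\<omega>. \<bar>V l (Y \<omega>)\<bar> + \<bar>V \<eta> (Y \<omega>)\<bar>)" using int by auto
  show "AE \<omega> in M. (\<lambda>n. indicat_real (B n) \<omega> *\<^sub>R V (q n) (Y \<omega>))
      \<longlonglongrightarrow> indicat_real C \<omega> *\<^sub>R V \<eta> (Y \<omega>)"
    using lim identification_function_left_limit[OF V q(1,2)]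
    by (intro AE_I2 tendsto_scaleR) auto
  show "AE \<omega> in M. norm (indicat_real (B n) \<omega> *\<^sub>R V (q n) (Y \<omega>))
      \<le> \<bar>V l (Y \<omega>)\<bar> + \<bar>V \<eta> (Y \<omega>)\<bar>" for n
  proof (rule AE_I2)
    fix \<omega>
    have "V l (Y \<omega>) \<le> V (q n) (Y \<omega>)" "V (q n) (Y \<omega>) \<le> V \<eta> (Y \<omega>)"
      using identification_function_mono[OF V] q(1,3) less_imp_le by blast+
    then show "norm (indicat_real (B n) \<omega> *\<^sub>R V (q n) (Y \<omega>)) \<le> \<bar>V l (Y \<omega>)\<bar> + \<bar>V \<eta> (Y \<omega>)\<bar>"
      by (auto simp: indicator_def)
  qed
qed

lemma conditional_functional_ge_minimizes:
  assumes lat: "sigma_lattice M \<A>" and V: "identification_function V"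
    and int: "\<And>\<eta>. integrable M (\<lambda>\<omega>. V \<eta> (Y \<omega>))"
    and path: "decreasing_minimizing_path M \<A> V Y A" and B: "B \<in> \<A>"
  shows "path_score M V Y {\<omega> \<in> space M. conditional_functional A \<omega> \<ge> ereal \<eta>} \<eta>
    \<le> path_score M V Y B \<eta>"
proof -
  \<comment> \<open>Approaching strictly from below matches left-continuity of \<open>V\<close>, and
    \<open>q 0 = \<eta> - 1\<close> serves as the lower bound \<open>l\<close> for the
    domination.\<close>
  define q where "q n = \<eta> - 1 / real (Suc n)" for n
  have q: "q n < \<eta>" "q \<longlonglongrightarrow> \<eta>" "\<eta> - 1 \<le> q n" for n
    using strict_left_approximation[of \<eta>] unfolding q_def by (simp_all add: field_simps)
  have "incseq q" by (auto simp: q_def incseq_def intro!: divide_left_mono)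
  note D = decreasing_minimizing_pathD[OF path]
  have sets: "C \<in> sets M" if "C \<in> \<A>" for C using that lat by (auto simp: sigma_lattice_def)
  have "{\<omega> \<in> space M. conditional_functional A \<omega> \<ge> ereal \<eta>} = (\<Inter>n. A (q n))"
  proof (intro set_eqI iffI)
    fix \<omega> assume "\<omega> \<in> {\<omega> \<in> space M. conditional_functional A \<omega> \<ge> ereal \<eta>}"
    then have "\<forall>n. \<exists>\<eta>>q n. \<omega> \<in> A \<eta>"
      by (simp add: ereal_le_iff_all_less[OF q(1,2)] less_conditional_functional_iff)
    then show "\<omega> \<in> (\<Inter>n. A (q n))" using D(3) less_imp_le by blast
  next
    fix \<omega> assume \<omega>: "\<omega> \<in> (\<Inter>n. A (q n))"
    \<comment> \<open>Membership in \<open>A (q (Suc n))\<close> supplies the threshold strictly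
      above \<open>q n\<close> that the supremum requires.\<close>
    have "q n < q (Suc n)" for n by (simp add: q_def field_simps)
    then have "\<forall>n. \<exists>\<eta>>q n. \<omega> \<in> A \<eta>" using \<omega> by blast
    then show "\<omega> \<in> {\<omega> \<in> space M. conditional_functional A \<omega> \<ge> ereal \<eta>}"
      using \<omega> sets.sets_into_space[OF sets[OF D(1)], of "q 0"]
      by (auto simp: ereal_le_iff_all_less[OF q(1,2)] less_conditional_functional_iff)
  qed
  moreover have "(\<lambda>n. path_score M V Y (A (q n)) (q n)) \<longlonglongrightarrow> path_score M V Y (\<Inter>n. A (q n)) \<eta>"
  proof (rule tendsto_path_score[OF V int q])
    have "decseq (\<lambda>n. A (q n))" using D(3) \<open>incseq q\<close> by (auto simp: decseq_def incseq_def)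
    then show "(\<lambda>n. indicator (A (q n)) \<omega>) \<longlonglongrightarrow> (indicator (\<Inter>n. A (q n)) \<omega> :: real)" for \<omega>
      by (rule LIMSEQ_indicator_decseq)
  qed (auto intro: sets D(1))
  \<comment> \<open>The competitor \<open>B\<close> stays fixed while the threshold moves, so the
    inequalities at the levels \<open>q n\<close> survive in the limit.\<close>
  moreover have "(\<lambda>n. path_score M V Y B (q n)) \<longlonglongrightarrow> path_score M V Y B \<eta>"
    by (rule tendsto_path_score[OF V int q]) (auto intro: sets B)
  ultimately show ?thesis using D(2)[OF B] by (auto intro: LIMSEQ_le)
qed

section \<open>Elementary losses for extended real forecasts\<close>

text \<open>The forecast enters only through the test \<eta> \<le> x, so the product form is
  meaningful for infinite forecasts as well.\<close>

definition extended_loss :: "(real \<Rightarrow> real \<Rightarrow> real) \<Rightarrow> real \<Rightarrow> ereal \<Rightarrow> real \<Rightarrow> real" where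
  "extended_loss V \<eta> x y = V \<eta> y * (of_bool (ereal \<eta> \<le> x) - of_bool (\<eta> \<le> y))"

lemma extended_loss_ereal: "extended_loss V \<eta> (ereal x) y = elementary_loss V \<eta> x y"
  by (auto simp: extended_loss_def elementary_loss_def)

text \<open>Two test forecasts reveal the sign of \<open>V\<close>: at x = \<eta> with y < \<eta>
  the loss is \<open>V \<eta> y\<close>, and at x = \<eta> - 1 with \<eta> \<le> y it is
  \<open>- V \<eta> y\<close>.\<close>

lemma elementary_loss_nonneg_sign:
  assumes "\<And>\<eta> x y. elementary_loss V \<eta> x y \<ge> 0"
  shows "y < \<eta> \<Longrightarrow> V \<eta> y \<ge> 0" "\<eta> \<le> y \<Longrightarrow> V \<eta> y \<le> 0"
  using assms[of \<eta> \<eta> y] assms[of \<eta> "\<eta> - 1" y] by (auto simp: elementary_loss_def)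

lemma extended_loss_nonneg:
  assumes "\<And>\<eta> x y. elementary_loss V \<eta> x y \<ge> 0"
  shows "extended_loss V \<eta> x y \<ge> 0"
  using elementary_loss_nonneg_sign[OF assms, where y = y and \<eta> = \<eta>]
  by (auto simp: extended_loss_def not_le)

text \<open>Moving the forecast away from y can only switch the loss from 0 to the absolute value of
  \<open>V \<eta> y\<close>. This monotonicity is what allows monotone convergence towards infinite
  forecasts.\<close>

lemma extended_loss_mono:
  assumes "\<And>\<eta> x y. elementary_loss V \<eta> x y \<ge> 0"
  shows "ereal y \<le> x \<Longrightarrow> x \<le> x' \<Longrightarrow> extended_loss V \<eta> x y \<le> extended_loss V \<eta> x' y"
    and "x' \<le> x \<Longrightarrow> x \<le> ereal y \<Longrightarrow> extended_loss V \<eta> x y \<le> extended_loss V \<eta> x' y"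
proof -
  assume x: "ereal y \<le> x" "x \<le> x'"
  have "\<eta> \<le> y \<Longrightarrow> ereal \<eta> \<le> x" using x(1) by (meson ereal_less_eq(3) order_trans)
  moreover have "ereal \<eta> \<le> x \<Longrightarrow> ereal \<eta> \<le> x'" using x(2) by (rule order_trans[rotated])
  ultimately show "extended_loss V \<eta> x y \<le> extended_loss V \<eta> x' y"
    using elementary_loss_nonneg_sign[OF assms, where y = y and \<eta> = \<eta>] by (auto simp: extended_loss_def)
next
  assume x: "x' \<le> x" "x \<le> ereal y"
  have "ereal \<eta> \<le> x \<Longrightarrow> \<eta> \<le> y" using x(2) by (meson ereal_less_eq(3) order_trans)
  moreover have "ereal \<eta> \<le> x' \<Longrightarrow> ereal \<eta> \<le> x" using x(1) by (rule order_trans[rotated])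
  ultimately show "extended_loss V \<eta> x y \<le> extended_loss V \<eta> x' y"
    using elementary_loss_nonneg_sign[OF assms, where y = y and \<eta> = \<eta>] by (auto simp: extended_loss_def)
qed

text \<open>Only the compositions \<open>V \<eta> \<circ> Y\<close> are known to be measurable; left-continuity gives joint
  measurability, by rounding \<open>\<eta>\<close> to the grid point strictly below it.\<close>

lemma measurable_left_continuous_composition:
  assumes V: "identification_function V"
    and meas: "\<And>\<eta>. (\<lambda>\<omega>. V \<eta> (Y \<omega>)) \<in> borel_measurable M"
  shows "(\<lambda>(\<omega>, \<eta>). V \<eta> (Y \<omega>)) \<in> borel_measurable (M \<Otimes>\<^sub>M borel)"
proof (rule borel_measurable_LIMSEQ_real)
  \<comment> \<open>Ceiling minus one, rather than floor, keeps \<open>q n \<eta>\<close> strictly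
    below \<eta> even when \<eta> is itself a grid point.\<close>
  define q where "q n \<eta> = real_of_int (\<lceil>real (Suc n) * \<eta>\<rceil> - 1) / real (Suc n)" for n :: nat and \<eta>
  have q: "q n \<eta> < \<eta>" "\<eta> - 1 / real (Suc n) \<le> q n \<eta>" for n \<eta>
  proof -
    let ?c = "real_of_int \<lceil>real (Suc n) * \<eta>\<rceil>"
    have "?c - 1 < real (Suc n) * \<eta>" "real (Suc n) * \<eta> \<le> ?c" by linarith+
    then show "q n \<eta> < \<eta>" "\<eta> - 1 / real (Suc n) \<le> q n \<eta>"
      unfolding q_def by (simp_all add: pos_divide_less_eq pos_le_divide_eq algebra_simps
        diff_divide_distrib)
  qed
  have lim: "(\<lambda>n. q n \<eta>) \<longlonglongrightarrow> \<eta>" for \<eta>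
    by (rule tendsto_sandwich[OF _ _ strict_left_approximation(2) tendsto_const])
       (use q in \<open>auto intro!: always_eventually less_imp_le[OF q(1)]\<close>)
  show "(\<lambda>n. case p of (\<omega>, \<eta>) \<Rightarrow> V (q n \<eta>) (Y \<omega>)) \<longlonglongrightarrow> (case p of (\<omega>, \<eta>) \<Rightarrow> V \<eta> (Y \<omega>))" for p
    using identification_function_left_limit[OF V q(1) lim] by (auto split: prod.split)
  fix n :: nat
  \<comment> \<open>The grid index k ranges over the integers, a countable set, so measurability is
    needed only for each fixed k, where it is that of a single composition of \<open>V\<close> with
    \<open>Y\<close>.\<close>
  have "(\<lambda>p. (\<lambda>k p. V (real_of_int (k - 1) / real (Suc n)) (Y (fst p)))
      \<lceil>real (Suc n) * snd p\<rceil> p) \<in> borel_measurable (M \<Otimes>\<^sub>M borel)"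
    by (rule measurable_compose_countable)
       (use meas in \<open>auto intro: measurable_compose[OF measurable_fst]\<close>)
  then show "(\<lambda>p. case p of (\<omega>, \<eta>) \<Rightarrow> V (q n \<eta>) (Y \<omega>)) \<in> borel_measurable (M \<Otimes>\<^sub>M borel)"
    by (simp add: q_def case_prod_beta)
qed

lemma measurable_extended_loss:
  assumes V: "identification_function V"
    and meas: "\<And>\<eta>. (\<lambda>\<omega>. V \<eta> (Y \<omega>)) \<in> borel_measurable M"
    and [measurable]: "X \<in> borel_measurable M" "Y \<in> borel_measurable M"
  shows "(\<lambda>(\<omega>, \<eta>). extended_loss V \<eta> (X \<omega>) (Y \<omega>)) \<in> borel_measurable (M \<Otimes>\<^sub>M borel)"
proof -
  note [measurable] = measurable_left_continuous_composition[OF V meas]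
  show ?thesis unfolding extended_loss_def by measurable
qed

section \<open>Scores at infinite forecasts\<close>

text \<open>Reduces a limit along real r to one along a sequence, the setting of the monotone
  convergence theorem.\<close>

lemma tendsto_at_top_if_eventually_mono:
  fixes f :: "real \<Rightarrow> 'b :: linorder_topology"
  assumes mono: "\<And>r s. c \<le> r \<Longrightarrow> r \<le> s \<Longrightarrow> f r \<le> f s"
    and lim: "(\<lambda>n. f (c + real n)) \<longlonglongrightarrow> L"
  shows "(f \<longlongrightarrow> L) at_top"
proof -
  have "mono (\<lambda>n. f (c + real n))" by (intro monoI mono) auto
  then have le: "f (c + real n) \<le> L" for n using lim by (rule incseq_le)
  show ?thesis
  proof (rule order_tendstoI)
    fix a assume "a < L"
    then obtain n where n: "a < f (c + real n)"
      using order_tendstoD(1)[OF lim] eventually_happens'[OF sequentially_bot] by blast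
    show "\<forall>\<^sub>F r in at_top. a < f r"
    proof (rule eventually_mono[OF eventually_ge_at_top[of "c + real n"]])
      fix r assume "c + real n \<le> r"
      then have "f (c + real n) \<le> f r" by (intro mono) auto
      then show "a < f r" using n by simp
    qed
  next
    fix a assume "L < a"
    have "f r \<le> L" if "c \<le> r" for r :: real
    proof -
      obtain n where "r - c \<le> real n" using real_arch_simple by blast
      then have "f r \<le> f (c + real n)" by (intro mono that) auto
      then show ?thesis using le order_trans by blast
    qed
    then show "\<forall>\<^sub>F r in at_top. f r < a"
      using \<open>L < a\<close> by (intro eventually_mono[OF eventually_ge_at_top[of c]]) (rule le_less_trans)
  qed
qed

text \<open>For real forecasts this is the representation, read as a nonnegative integral. For
  infinite ones the limit in \<open>extend_score\<close> passes under the integral by monotone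
  convergence.\<close>

lemma extend_score_eq:
  assumes nn: "\<And>\<eta> x y. elementary_loss V \<eta> x y \<ge> 0"
    and rep: "has_elementary_representation V H S"
  shows "extend_score S x y = enn2ereal (\<integral>\<^sup>+\<eta>. ennreal (extended_loss V \<eta> x y) \<partial>H)"
proof -
  let ?I = "\<lambda>x. \<integral>\<^sup>+\<eta>. ennreal (extended_loss V \<eta> x y) \<partial>H"
  have meas: "(\<lambda>\<eta>. ennreal (extended_loss V \<eta> (ereal r) y)) \<in> borel_measurable H" for r
  proof -
    have "(\<lambda>\<eta>. ereal (elementary_loss V \<eta> r y)) \<in> borel_measurable H"
      using rep by (auto simp: has_elementary_representation_def ext_integral_exists_def)
    then show ?thesis by (simp add: extended_loss_ereal)
  qed
  \<comment> \<open>The loss is nonnegative, so the negative part in \<open>ext_integral\<close>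
    vanishes.\<close>
  have S: "S r y = enn2ereal (?I (ereal r))" for r
  proof -
    have "e2ennreal (- ereal (elementary_loss V \<eta> r y)) = 0" for \<eta>
      using nn by (intro e2ennreal_neg) auto
    moreover have "e2ennreal (ereal (elementary_loss V \<eta> r y)) = ennreal (extended_loss V \<eta> (ereal r) y)" for \<eta>
      by (simp add: extended_loss_ereal ennreal.abs_eq)
    ultimately show ?thesis
      using rep by (simp add: has_elementary_representation_def ext_integral_def zero_ennreal.rep_eq
          del: uminus_ereal.simps)
  qed
  show ?thesis
  proof (cases x)
    case (real r)
    then show ?thesis by (simp add: extend_score_def S)
  next
    case PInf
    have "((\<lambda>r. ?I (ereal r)) \<longlongrightarrow> ?I \<infinity>) at_top"
    proof (rule tendsto_at_top_if_eventually_mono[where c = y])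
      show "?I (ereal r) \<le> ?I (ereal s)" if "y \<le> r" "r \<le> s" for r s
        using that by (intro nn_integral_mono ennreal_leI extended_loss_mono(1)[OF nn]) auto
      show "(\<lambda>n. ?I (ereal (y + real n))) \<longlonglongrightarrow> ?I \<infinity>"
      proof (rule nn_integral_LIMSEQ)
        show "incseq (\<lambda>n \<eta>. ennreal (extended_loss V \<eta> (ereal (y + real n)) y))"
          by (intro monoI le_funI ennreal_leI extended_loss_mono(1)[OF nn]) auto
        fix \<eta>
        \<comment> \<open>Once the forecast reaches \<eta>, the loss already has its value at
          \<infinity>; pointwise convergence is eventual equality.\<close>
        obtain N where "\<eta> - y \<le> real N" using real_arch_simple by blast
        then have "\<forall>n\<ge>N. extended_loss V \<eta> (ereal (y + real n)) y = extended_loss V \<eta> \<infinity> y"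
          by (auto simp: extended_loss_def)
        then show "(\<lambda>n. ennreal (extended_loss V \<eta> (ereal (y + real n)) y))
            \<longlonglongrightarrow> ennreal (extended_loss V \<eta> \<infinity> y)"
          by (intro tendsto_eventually eventually_sequentiallyI[of N]) simp
      qed (rule meas)
    qed
    from tendsto_enn2erealI[OF this] show ?thesis
      using PInf by (auto simp: extend_score_def S intro!: tendsto_Lim)
  next
    case MInf
    \<comment> \<open>Reflecting r turns the limit at -\<infinity> into one at +\<infinity>; the
      loss increases in the reflected variable from \<open>- y\<close> on.\<close>
    have "((\<lambda>r. ?I (ereal (- r))) \<longlongrightarrow> ?I (- \<infinity>)) at_top"
    proof (rule tendsto_at_top_if_eventually_mono[where c = "- y"])
      show "?I (ereal (- r)) \<le> ?I (ereal (- s))" if "- y \<le> r" "r \<le> s" for r s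
        using that by (intro nn_integral_mono ennreal_leI extended_loss_mono(2)[OF nn]) auto
      show "(\<lambda>n. ?I (ereal (- (- y + real n)))) \<longlonglongrightarrow> ?I (- \<infinity>)"
      proof (rule nn_integral_LIMSEQ)
        show "incseq (\<lambda>n \<eta>. ennreal (extended_loss V \<eta> (ereal (- (- y + real n))) y))"
          by (intro monoI le_funI ennreal_leI extended_loss_mono(2)[OF nn]) auto
        fix \<eta>
        \<comment> \<open>The bound is strict here: the test \<eta> \<le> y - n must fail, as it
          does at -\<infinity>.\<close>
        obtain N where "y - \<eta> < real N" using reals_Archimedean2 by blast
        then have "\<forall>n\<ge>N. extended_loss V \<eta> (ereal (- (- y + real n))) y
            = extended_loss V \<eta> (- \<infinity>) y"
          by (auto simp: extended_loss_def)
        then show "(\<lambda>n. ennreal (extended_loss V \<eta> (ereal (- (- y + real n))) y))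
            \<longlonglongrightarrow> ennreal (extended_loss V \<eta> (- \<infinity>) y)"
          by (intro tendsto_eventually eventually_sequentiallyI[of N]) simp
      qed (rule meas)
    qed
    then have "((\<lambda>r. ?I (ereal r)) \<longlongrightarrow> ?I (- \<infinity>)) at_bot"
      by (simp add: filterlim_at_bot_mirror)
    from tendsto_enn2erealI[OF this] show ?thesis
      using MInf by (auto simp: extend_score_def S intro!: tendsto_Lim)
  qed
qed

section \<open>Expected scores\<close>

lemma ext_integral_enn2ereal:
  assumes "f \<in> borel_measurable M"
  shows "ext_integral_exists M (\<lambda>\<omega>. enn2ereal (f \<omega>))"
    and "ext_integral M (\<lambda>\<omega>. enn2ereal (f \<omega>)) = enn2ereal (\<integral>\<^sup>+\<omega>. f \<omega> \<partial>M)"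
  using assms by (auto simp: ext_integral_exists_def ext_integral_def e2ennreal_neg zero_ennreal.rep_eq)

text \<open>The difference of indicators integrates to a difference of two path scores, of which
  only the first involves \<open>X\<close>. That difference is nonnegative because the loss is, so
  \<open>ennreal\<close> truncates nothing.\<close>

lemma nn_integral_extended_loss:
  assumes nn: "\<And>\<eta> x y. elementary_loss V \<eta> x y \<ge> 0"
    and int: "integrable M (\<lambda>\<omega>. V \<eta> (Y \<omega>))"
    and [measurable]: "X \<in> borel_measurable M" "Y \<in> borel_measurable M"
  shows "(\<integral>\<^sup>+\<omega>. ennreal (extended_loss V \<eta> (X \<omega>) (Y \<omega>)) \<partial>M)
    = ennreal (path_score M V Y {\<omega> \<in> space M. X \<omega> \<ge> ereal \<eta>} \<eta>
        - path_score M V Y {\<omega> \<in> space M. Y \<omega> \<ge> \<eta>} \<eta>)"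
proof -
  let ?B = "{\<omega> \<in> space M. X \<omega> \<ge> ereal \<eta>}" and ?C = "{\<omega> \<in> space M. Y \<omega> \<ge> \<eta>}"
  have i: "integrable M (\<lambda>\<omega>. indicat_real D \<omega> *\<^sub>R V \<eta> (Y \<omega>))" if "D \<in> sets M" for D
    using integrable_mult_indicator[OF that int] .
  have B: "?B \<in> sets M" and C: "?C \<in> sets M" by measurable
  have eq: "extended_loss V \<eta> (X \<omega>) (Y \<omega>)
      = indicat_real ?B \<omega> *\<^sub>R V \<eta> (Y \<omega>) - indicat_real ?C \<omega> *\<^sub>R V \<eta> (Y \<omega>)"
    if "\<omega> \<in> space M" for \<omega>
    using that by (auto simp: extended_loss_def)
  have "integrable M (\<lambda>\<omega>. extended_loss V \<eta> (X \<omega>) (Y \<omega>))"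
    using Bochner_Integration.integrable_diff[OF i[OF B] i[OF C]] eq
    by (subst Bochner_Integration.integrable_cong[OF refl]) auto
  moreover have "(\<integral>\<omega>. extended_loss V \<eta> (X \<omega>) (Y \<omega>) \<partial>M)
      = path_score M V Y ?B \<eta> - path_score M V Y ?C \<eta>"
    unfolding path_score_def set_lebesgue_integral_def
    by (subst Bochner_Integration.integral_diff[OF i[OF B] i[OF C], symmetric])
       (rule Bochner_Integration.integral_cong[OF refl eq])
  ultimately show ?thesis
    using extended_loss_nonneg[OF nn] by (subst nn_integral_eq_integral) auto
qed

text \<open>Tonelli exchanges the expectation with the mixture over \<eta>, so the forecast enters
  the expected score only through the path scores of its level sets. The integral exists because the
  integrand is nonnegative.\<close>

lemma expected_extend_score:
  assumes "prob_space M" and Y: "Y \<in> borel_measurable M" and V: "identification_function V"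
    and int: "\<And>\<eta>. integrable M (\<lambda>\<omega>. V \<eta> (Y \<omega>))"
    and nn: "\<And>\<eta> x y. elementary_loss V \<eta> x y \<ge> 0"
    and "sigma_finite_measure H" and sets: "sets H = sets borel"
    and rep: "has_elementary_representation V H S"
    and X: "X \<in> borel_measurable M"
  shows "ext_integral_exists M (\<lambda>\<omega>. extend_score S (X \<omega>) (Y \<omega>))"
    and "ext_integral M (\<lambda>\<omega>. extend_score S (X \<omega>) (Y \<omega>))
      = enn2ereal (\<integral>\<^sup>+\<eta>. ennreal (path_score M V Y {\<omega> \<in> space M. X \<omega> \<ge> ereal \<eta>} \<eta>
          - path_score M V Y {\<omega> \<in> space M. Y \<omega> \<ge> \<eta>} \<eta>) \<partial>H)"
proof -
  interpret prob_space M by fact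
  interpret H: sigma_finite_measure H by fact
  interpret pair_sigma_finite M H ..
  \<comment> \<open>Joint measurability was shown for the Borel sets; it carries over to
    \<open>H\<close>, which has the same measurable sets.\<close>
  have pm [measurable_cong]: "sets (M \<Otimes>\<^sub>M H) = sets (M \<Otimes>\<^sub>M borel)"
    by (rule sets_pair_measure_cong[OF refl sets])
  have "(\<lambda>(\<omega>, \<eta>). extended_loss V \<eta> (X \<omega>) (Y \<omega>)) \<in> borel_measurable (M \<Otimes>\<^sub>M borel)"
    by (rule measurable_extended_loss[OF V _ X Y]) (use int in auto)
  then have m: "(\<lambda>(\<omega>, \<eta>). ennreal (extended_loss V \<eta> (X \<omega>) (Y \<omega>))) \<in> borel_measurable (M \<Otimes>\<^sub>M H)"
    by (simp add: case_prod_beta cong: measurable_cong_sets)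
  have m': "(\<lambda>\<omega>. \<integral>\<^sup>+\<eta>. ennreal (extended_loss V \<eta> (X \<omega>) (Y \<omega>)) \<partial>H) \<in> borel_measurable M"
    using H.borel_measurable_nn_integral[OF m] .
  show "ext_integral_exists M (\<lambda>\<omega>. extend_score S (X \<omega>) (Y \<omega>))"
    unfolding extend_score_eq[OF nn rep] by (rule ext_integral_enn2ereal(1)[OF m'])
  show "ext_integral M (\<lambda>\<omega>. extend_score S (X \<omega>) (Y \<omega>))
      = enn2ereal (\<integral>\<^sup>+\<eta>. ennreal (path_score M V Y {\<omega> \<in> space M. X \<omega> \<ge> ereal \<eta>} \<eta>
          - path_score M V Y {\<omega> \<in> space M. Y \<omega> \<ge> \<eta>} \<eta>) \<partial>H)"
    unfolding extend_score_eq[OF nn rep] ext_integral_enn2ereal(2)[OF m']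
      nn_integral_extended_loss[OF nn int X Y, symmetric]
    using Fubini'[OF m] by simp
qed

theorem proposition6p3:
  fixes M :: "'a measure" and \<A> :: "'a set set" and Y :: "'a \<Rightarrow> real"
    and V :: "real \<Rightarrow> real \<Rightarrow> real" and A :: "real \<Rightarrow> 'a set"
  assumes "prob_space M"
    and "sigma_lattice M \<A>"
    and "Y \<in> borel_measurable M"
    and "identification_function V"
    and "\<And>\<eta>. integrable M (\<lambda>\<omega>. V \<eta> (Y \<omega>))"
    and "decreasing_minimizing_path M \<A> V Y A"
  shows "lattice_measurable M \<A> (conditional_functional A)
    \<and> (\<forall>\<eta>::real. \<forall>X. lattice_measurable M \<A> X \<longrightarrow>
         (LINT \<omega>:{\<omega> \<in> space M. conditional_functional A \<omega> \<ge> ereal \<eta>}|M. V \<eta> (Y \<omega>))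
         \<le> (LINT \<omega>:{\<omega> \<in> space M. X \<omega> \<ge> ereal \<eta>}|M. V \<eta> (Y \<omega>)))
    \<and> ((\<forall>\<eta> x y. elementary_loss V \<eta> x y \<ge> 0) \<longrightarrow>
         (\<forall>\<P> S H. (\<forall>F\<in>\<P>. real_distribution F)
            \<and> consistent_scoring_function \<P> (induced_functional V) S
            \<and> sigma_finite_measure H \<and> sets H = sets borel
            \<and> has_elementary_representation V H S \<longrightarrow>
            (\<forall>X. lattice_measurable M \<A> X \<longrightarrow>
               ext_integral_exists M (\<lambda>\<omega>. extend_score S (X \<omega>) (Y \<omega>))
               \<and> ext_integral M (\<lambda>\<omega>. extend_score S (conditional_functional A \<omega>) (Y \<omega>))
                 \<le> ext_integral M (\<lambda>\<omega>. extend_score S (X \<omega>) (Y \<omega>)))))"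
proof (intro conjI allI impI)
  let ?T = "conditional_functional A"
  note min = conditional_functional_ge_minimizes[OF assms(2,4,5,6)]
  show T: "lattice_measurable M \<A> ?T"
    by (rule lattice_measurable_conditional_functional[OF assms(2,6)])
  \<comment> \<open>The level set of \<open>X\<close> lies in \<A>, hence is an admissible
    competitor.\<close>
  show "(LINT \<omega>:{\<omega> \<in> space M. ?T \<omega> \<ge> ereal \<eta>}|M. V \<eta> (Y \<omega>))
      \<le> (LINT \<omega>:{\<omega> \<in> space M. X \<omega> \<ge> ereal \<eta>}|M. V \<eta> (Y \<omega>))"
    if "lattice_measurable M \<A> X" for \<eta> X
    using min[OF lattice_measurable_ge[OF assms(2) that]] by (simp add: path_score_def)
  fix \<P> S H X
  assume nn: "\<forall>\<eta> x y. elementary_loss V \<eta> x y \<ge> 0"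
    and H: "(\<forall>F\<in>\<P>. real_distribution F)
      \<and> consistent_scoring_function \<P> (induced_functional V) S
      \<and> sigma_finite_measure H \<and> sets H = sets borel
      \<and> has_elementary_representation V H S"
    and X: "lattice_measurable M \<A> X"
  note E = expected_extend_score[OF assms(1,3,4,5) nn[rule_format], of H S]
  note borel = lattice_measurable_borel[OF assms(2)]
  show "ext_integral_exists M (\<lambda>\<omega>. extend_score S (X \<omega>) (Y \<omega>))"
    using E(1) H borel[OF X] by blast
  have "ext_integral M (\<lambda>\<omega>. extend_score S (Z \<omega>) (Y \<omega>))
      = enn2ereal (\<integral>\<^sup>+\<eta>. ennreal (path_score M V Y {\<omega> \<in> space M. Z \<omega> \<ge> ereal \<eta>} \<eta>
          - path_score M V Y {\<omega> \<in> space M. Y \<omega> \<ge> \<eta>} \<eta>) \<partial>H)"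
    if "lattice_measurable M \<A> Z" for Z
    using E(2) H borel[OF that] by blast
  \<comment> \<open>At each \<eta> the \<open>Y\<close>-term is common to both sides and the level
    set of \<open>?T\<close> is minimal, so the integrands compare pointwise. The comparison takes
    place in \<open>ennreal\<close>, so infinite expected scores are covered.\<close>
  then show "ext_integral M (\<lambda>\<omega>. extend_score S (?T \<omega>) (Y \<omega>))
      \<le> ext_integral M (\<lambda>\<omega>. extend_score S (X \<omega>) (Y \<omega>))"
    using T X min[OF lattice_measurable_ge[OF assms(2) X]]
    by (auto simp: less_eq_ennreal.rep_eq[symmetric] intro!: nn_integral_mono ennreal_leI)
qed

end
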